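(* Let $\mathcal{E}$ be a quantum channel on a $d$-dimensional complex Hilbert space $\mathcal{H}$ for which an optimum pair exists. Then there exists an optimum pair $(\mathcal{S},\mathcal{P})$ for $\mathcal{E}$ in which $\mathcal{S}$ is composed only of pure states, i.e. $\mathcal{S}=\{\rho_i=|v_i\rangle\langle v_i|\}$ with unit vectors $|v_i\rangle\in\mathcal{H}$. In other words, the zero-error capacity of $\mathcal{E}$ is attained using only pure input states.
   Context: A quantum state on $\mathcal{H}$ is a positive semidefinite operator of trace one. A quantum channel is a completely positive trace-preserving linear map $\mathcal{E}(\rho)=\sum_a E_a\rho E_a^\dagger$ with finitely many operators $E_a$ on $\mathcal{H}$ satisfying $\sum_a E_a^\dagger E_a=\mathbb{1}$. A POVM is a finite family $\{M_1,\dots,M_m\}$ of positive semidefinite operators on $\mathcal{H}$ with $\sum_j M_j=\mathbb{1}$. For a fixed channel $\mathcal{E}$, two states $\rho_1,\rho_2$ are non-adjacent with respect to a POVM $\{M_j\}_{j=1}^m$ if $A_1\cap A_2=\emptyset$, where $A_k=\{j\in\{1,\dots,m\} : \mathrm{tr}[\mathcal{E}(\rho_k)M_j]>0\}$ for $k=1,2$. Given a finite nonempty set $\mathcal{S}=\{\rho_1,\dots,\rho_l\}$ of states on $\mathcal{H}$ and a POVM $\mathcal{P}$, the characteristic graph $\mathcal{G}=\mathcal{G}(\mathcal{S},\mathcal{P})$ has one vertex for each element of $\mathcal{S}$, and two vertices are connected by an edge iff the corresponding states are non-adjacent with respect to $\mathcal{P}$. The $n$-product graph $\mathcal{G}^n$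 has as vertices the $n$-tuples of vertices of $\mathcal{G}$, two $n$-tuples being connected iff in at least one coordinate their entries are connected in $\mathcal{G}$. Let $\omega$ denote the clique number. The zero-error capacity of $\mathcal{E}$ is $$C^{(0)}(\mathcal{E})=\sup_{(\mathcal{S},\mathcal{P})}\ \sup_{n\ge 1}\ \frac1n\log\omega\big(\mathcal{G}(\mathcal{S},\mathcal{P})^n\big),$$ the outer supremum being over all finite nonempty sets $\mathcal{S}$ of states and all POVMs $\mathcal{P}$ on $\mathcal{H}$. A pair $(\mathcal{S},\mathcal{P})$ is called optimum for $\mathcal{E}$ if it attains the outer supremum, i.e. $\sup_{n}\frac1n\log\omega(\mathcal{G}(\mathcal{S},\mathcal{P})^n)=C^{(0)}(\mathcal{E})$. *)

theory Defs
  imports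
    "HOL-Analysis.Analysis"
    "HOL-Library.Complex_Order"
    "HOL-Library.Ramsey"
begin

section \<open>Operators, states, channels and measurements\<close>

text \<open>
  The Hilbert space of dimension \<open>d = CARD('d)\<close> is \<open>complex ^ 'd\<close>, and operators on it are
  square complex matrices. The order on \<open>complex\<close> makes \<open>0 \<le> z\<close> and \<open>0 < z\<close>
  mean that \<open>z\<close> is real and nonnegative, respectively positive.
\<close>

definition conj_transpose :: "complex^'n^'m \<Rightarrow> complex^'m^'n" where
  "conj_transpose A = transpose (map_matrix cnj A)"

text \<open>
  The inner product \<open>\<bullet>\<close> of the library is the real one, so the sesquilinear one is
  introduced here; it is conjugate linear in its first argument.
\<close>

definition braket :: "complex^'d \<Rightarrow> complex^'d \<Rightarrow> complex" where
  "braket u v = (\<Sum>i\<in>UNIV. cnj (u $ i) * v $ i)"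

definition ketbra :: "complex^'d \<Rightarrow> complex^'d \<Rightarrow> complex^'d^'d" where
  "ketbra u v = (\<chi> i j. u $ i * cnj (v $ j))"

definition pos_semidef :: "complex^'d^'d \<Rightarrow> bool" where
  "pos_semidef A \<longleftrightarrow> (\<forall>v. 0 \<le> braket v (A *v v))"

definition quantum_state :: "complex^'d^'d \<Rightarrow> bool" where
  "quantum_state \<rho> \<longleftrightarrow> pos_semidef \<rho> \<and> trace \<rho> = 1"

definition pure_state :: "complex^'d^'d \<Rightarrow> bool" where
  "pure_state \<rho> \<longleftrightarrow> (\<exists>v. norm v = 1 \<and> \<rho> = ketbra v v)"

text \<open>
  Complete positivity is expressed by the existence of an operator-sum (Kraus) representation.
\<close>

definition quantum_channel :: "(complex^'d^'d \<Rightarrow> complex^'d^'d) \<Rightarrow> bool" where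
  "quantum_channel \<E> \<longleftrightarrow>
    (\<exists>(m::nat) (K :: nat \<Rightarrow> complex^'d^'d).
       (\<Sum>a<m. conj_transpose (K a) ** K a) = mat 1 \<and>
       (\<forall>\<rho>. \<E> \<rho> = (\<Sum>a<m. K a ** \<rho> ** conj_transpose (K a))))"

text \<open>A measurement is a list, since a finite family may repeat an operator.\<close>

definition povm :: "(complex^'d^'d) list \<Rightarrow> bool" where
  "povm P \<longleftrightarrow> (\<forall>M\<in>set P. pos_semidef M) \<and> sum_list P = mat 1"


section \<open>Graphs\<close>

text \<open>
  A graph is a pair of a vertex set and a set of edges, an edge between \<open>x\<close> and \<open>y\<close>
  being the set \<open>{x, y}\<close>; this matches the library constant \<^const>\<open>clique\<close>.
\<close>

type_synonym 'a graph = "'a set \<times> 'a set set"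

definition clique_number :: "'a graph \<Rightarrow> nat" where
  "clique_number G = Max {card C | C. C \<subseteq> fst G \<and> clique C (snd G)}"

definition product_graph :: "nat \<Rightarrow> 'a graph \<Rightarrow> 'a list graph" where
  "product_graph n G =
    (let V = {xs. set xs \<subseteq> fst G \<and> length xs = n}
     in (V, {{xs, ys} | xs ys. xs \<in> V \<and> ys \<in> V \<and> (\<exists>i<n. {xs ! i, ys ! i} \<in> snd G)}))"


section \<open>Zero-error capacity\<close>

definition outcomes ::
  "(complex^'d^'d \<Rightarrow> complex^'d^'d) \<Rightarrow> (complex^'d^'d) list \<Rightarrow> complex^'d^'d \<Rightarrow> nat set" where
  "outcomes \<E> P \<rho> = {j. j < length P \<and> 0 < trace (\<E> \<rho> ** P ! j)}"

definition non_adjacent ::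
  "(complex^'d^'d \<Rightarrow> complex^'d^'d) \<Rightarrow> (complex^'d^'d) list \<Rightarrow>
   complex^'d^'d \<Rightarrow> complex^'d^'d \<Rightarrow> bool" where
  "non_adjacent \<E> P \<rho>\<^sub>1 \<rho>\<^sub>2 \<longleftrightarrow> outcomes \<E> P \<rho>\<^sub>1 \<inter> outcomes \<E> P \<rho>\<^sub>2 = {}"

text \<open>
  For a channel, a measurement and a state the outcome set is never empty (the outcome
  probabilities sum to one), so no state is non-adjacent to itself and the graph has no loops.
\<close>

definition characteristic_graph ::
  "(complex^'d^'d \<Rightarrow> complex^'d^'d) \<Rightarrow> (complex^'d^'d) set \<Rightarrow> (complex^'d^'d) list \<Rightarrow>
   (complex^'d^'d) graph" where
  "characteristic_graph \<E> S P =
    (S, {{\<rho>\<^sub>1, \<rho>\<^sub>2} | \<rho>\<^sub>1 \<rho>\<^sub>2. \<rho>\<^sub>1 \<in> S \<and> \<rho>\<^sub>2 \<in> S \<and> non_adjacent \<E> P \<rho>\<^sub>1 \<rho>\<^sub>2})"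

definition admissible_pair :: "(complex^'d^'d) set \<Rightarrow> (complex^'d^'d) list \<Rightarrow> bool" where
  "admissible_pair S P \<longleftrightarrow> finite S \<and> S \<noteq> {} \<and> (\<forall>\<rho>\<in>S. quantum_state \<rho>) \<and> povm P"

text \<open>
  Rates are extended reals, so that every supremum below is a genuine one without a
  boundedness side condition. Logarithms are binary.
\<close>

definition pair_rate ::
  "(complex^'d^'d \<Rightarrow> complex^'d^'d) \<Rightarrow> (complex^'d^'d) set \<Rightarrow> (complex^'d^'d) list \<Rightarrow> ereal" where
  "pair_rate \<E> S P =
    (SUP n\<in>{1..}. ereal
       (1 / real n * log 2 (real (clique_number (product_graph n (characteristic_graph \<E> S P))))))"

definition zero_error_capacity :: "(complex^'d^'d \<Rightarrow> complex^'d^'d) \<Rightarrow> ereal" where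
  "zero_error_capacity \<E> = (SUP (S, P)\<in>{(S, P). admissible_pair S P}. pair_rate \<E> S P)"

definition optimum_pair ::
  "(complex^'d^'d \<Rightarrow> complex^'d^'d) \<Rightarrow> (complex^'d^'d) set \<Rightarrow> (complex^'d^'d) list \<Rightarrow> bool" where
  "optimum_pair \<E> S P \<longleftrightarrow> admissible_pair S P \<and> pair_rate \<E> S P = zero_error_capacity \<E>"

end

theory Submission
  imports Defs
begin

text \<open>
  A mixed state \<open>\<rho>\<close> is a finite sum of rank-one operators \<open>|v\<rangle>\<langle>v|\<close>. Outcome
  probabilities are additive and nonnegative on such sums, so the normalisation of any nonzero
  \<open>v\<close> occurring there is a pure state that can only trigger outcomes that \<open>\<rho>\<close> can trigger.
  Replacing every input state in this way keeps all edges of the characteristic graph. Adjacent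
  states are not merged, since outcome sets are nonempty, so cliques of the product graphs are
  mapped injectively to cliques and the rate does not drop.
\<close>

section \<open>Sesquilinear algebra\<close>

lemma braket_add_left: "braket (u + u') v = braket u v + braket u' v"
  by (simp add: braket_def sum.distrib algebra_simps)

lemma braket_add_right: "braket u (v + v') = braket u v + braket u v'"
  by (simp add: braket_def sum.distrib algebra_simps)

lemma braket_smult_left: "braket (c *s u) v = cnj c * braket u v"
  by (simp add: braket_def sum_distrib_left algebra_simps)

lemma braket_smult_right: "braket u (c *s v) = c * braket u v"
  by (simp add: braket_def sum_distrib_left algebra_simps)

lemma braket_axis_left: "braket (axis i 1) v = v $ i"
proof -
  have "cnj (axis i 1 $ j) * v $ j = (if j = i then v $ j else 0)" for j
    by (simp add: axis_def)
  then show ?thesis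
    by (simp add: braket_def)
qed

lemma braket_self: "braket v v = of_real ((norm v)\<^sup>2)"
proof -
  have "cnj (v $ i) * v $ i = of_real ((norm (v $ i))\<^sup>2)" for i
    by (metis complex_norm_square mult.commute)
  then show ?thesis
    by (simp add: braket_def norm_vec_def L2_set_def sum_nonneg)
qed

lemma braket_conj_transpose: "braket u (conj_transpose A *v v) = braket (A *v u) v"
proof -
  have "braket u (conj_transpose A *v v)
      = (\<Sum>i\<in>UNIV. \<Sum>j\<in>UNIV. cnj (u $ i) * (cnj (A $ j $ i) * v $ j))"
    by (simp add: braket_def conj_transpose_def matrix_vector_mult_def transpose_def
        map_matrix_def sum_distrib_left)
  also have "\<dots> = (\<Sum>j\<in>UNIV. \<Sum>i\<in>UNIV. cnj (u $ i) * (cnj (A $ j $ i) * v $ j))"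
    by (rule sum.swap)
  also have "\<dots> = braket (A *v u) v"
    by (simp add: braket_def matrix_vector_mult_def sum_distrib_left sum_distrib_right algebra_simps)
  finally show ?thesis .
qed

text \<open>Cyclicity of the trace turns outcome probabilities into values of a quadratic form, to
  which \<open>pos_semidef\<close> applies directly.\<close>

lemma trace_ketbra_mult: "trace (ketbra u v ** M) = braket v (M *v u)"
proof -
  have "trace (ketbra u v ** M) = (\<Sum>i\<in>UNIV. \<Sum>k\<in>UNIV. u $ i * cnj (v $ k) * M $ k $ i)"
    by (simp add: trace_def matrix_matrix_mult_def ketbra_def)
  also have "\<dots> = (\<Sum>k\<in>UNIV. \<Sum>i\<in>UNIV. u $ i * cnj (v $ k) * M $ k $ i)"
    by (rule sum.swap)
  also have "\<dots> = braket v (M *v u)"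
    by (simp add: braket_def matrix_vector_mult_def sum_distrib_left algebra_simps)
  finally show ?thesis .
qed

lemma trace_ketbra: "trace (ketbra v v) = of_real ((norm v)\<^sup>2)"
  using trace_ketbra_mult[of v v "mat 1"] by (simp add: braket_self)

text \<open>A Kraus operator keeps rank-one operators rank-one, so a channel output on
  \<open>ketbra v v\<close> is again a finite sum of such operators.\<close>

lemma matrix_mult_ketbra_conj_transpose:
  "K ** ketbra u v ** conj_transpose L = ketbra (K *v u) (L *v v)"
  by (simp add: vec_eq_iff matrix_matrix_mult_def ketbra_def conj_transpose_def transpose_def
      map_matrix_def matrix_vector_mult_def sum_distrib_left sum_distrib_right algebra_simps)

section \<open>Positive semidefinite matrices as sums of rank-one matrices\<close>

lemma matrix_vector_mult_axis: "(A *v axis i 1) $ j = (A $ j $ i :: complex)"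
proof -
  have "A $ j $ k * axis i 1 $ k = (if k = i then A $ j $ k else 0)" for k
    by (simp add: axis_def)
  then show ?thesis
    by (simp add: matrix_vector_mult_def)
qed

text \<open>The form at \<open>axis j 1 + c *s axis k 1\<close>. Suitable values of \<open>c\<close>
  extract all the entrywise facts below.\<close>

lemma pos_semidef_2x2:
  assumes "pos_semidef A"
  shows "0 \<le> A $ j $ j + c * A $ j $ k + cnj c * (A $ k $ j + c * A $ k $ k)"
proof -
  have "0 \<le> braket (axis j 1 + c *s axis k 1) (A *v (axis j 1 + c *s axis k 1))"
    using assms by (simp add: pos_semidef_def)
  then show ?thesis
    by (simp add: matrix_vector_right_distrib vector_scalar_commute braket_add_left
        braket_smult_left braket_axis_left matrix_vector_mult_axis)
qed

lemma pos_semidef_diag: "pos_semidef A \<Longrightarrow> 0 \<le> A $ j $ j"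
  using pos_semidef_2x2[of A j 0 j] by simp

text \<open>Polarization: the form is real, and the imaginary parts at \<open>c = 1\<close> and
  \<open>c = \<i>\<close> compare the imaginary and the real parts of the two entries.\<close>

lemma pos_semidef_hermitian:
  assumes "pos_semidef A"
  shows "A $ k $ j = cnj (A $ j $ k)"
proof -
  have "Im (A $ j $ j) = 0" "Im (A $ k $ k) = 0"
    using pos_semidef_diag[OF assms] by (simp_all add: less_eq_complex_def)
  then show ?thesis
    using pos_semidef_2x2[OF assms, of j 1 k] pos_semidef_2x2[OF assms, of j \<i> k]
    by (simp add: less_eq_complex_def complex_eq_iff)
qed

lemma pos_semidef_zero_diag:
  assumes "pos_semidef A" and "\<And>i. A $ i $ i = 0"
  shows "A = 0"
proof -
  have "A $ j $ k = 0" for j k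
  proof -
    \<comment> \<open>With zero diagonal, the choice \<open>c = - cnj (A $ j $ k)\<close> makes the
      form equal to minus twice the squared modulus of the entry.\<close>
    have "0 \<le> Re (- cnj (A $ j $ k) * A $ j $ k + - A $ j $ k * cnj (A $ j $ k))"
      using pos_semidef_2x2[OF assms(1), of j "- cnj (A $ j $ k)" k]
        pos_semidef_hermitian[OF assms(1), of k j] assms(2)
      by (simp add: less_eq_complex_def)
    then have "(Re (A $ j $ k))\<^sup>2 + (Im (A $ j $ k))\<^sup>2 \<le> 0"
      by (simp add: power2_eq_square)
    then show ?thesis
      by (simp add: sum_power2_le_zero_iff complex_eq_iff)
  qed
  then show ?thesis
    by (simp add: vec_eq_iff)
qed

text \<open>
  The form of the Schur complement at \<open>v\<close> is that of \<open>A\<close> at \<open>v - ((A v)\<^sub>i / A\<^sub>i\<^sub>i) e\<^sub>i\<close>.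
\<close>

lemma pos_semidef_schur_complement:
  assumes A: "pos_semidef A" and nz: "A $ i $ i \<noteq> 0"
  shows "pos_semidef (\<chi> j k. A $ j $ k - A $ j $ i * A $ i $ k / A $ i $ i)"
    (is "pos_semidef ?B")
  unfolding pos_semidef_def
proof
  fix v
  define b where "b = (A *v v) $ i / A $ i $ i"
  define u where "u = v + (- b) *s axis i 1"
  have Au: "(A *v u) $ j = (A *v v) $ j - A $ j $ i * b" for j
    by (simp only: u_def matrix_vector_right_distrib vector_scalar_commute vector_add_component
        vector_smult_component matrix_vector_mult_axis) simp
  have "(?B *v v) $ j = (A *v v) $ j - A $ j $ i * b" for j
    by (simp add: b_def matrix_vector_mult_def algebra_simps sum_subtractf sum_distrib_left
        sum_divide_distrib)
  then have "?B *v v = A *v u"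
    by (simp add: vec_eq_iff Au)
  \<comment> \<open>\<open>u\<close> and \<open>v\<close> differ only in coordinate
    \<open>i\<close>, where \<open>A *v u\<close> vanishes, so either may stand on the left of the
    bracket.\<close>
  moreover have "(A *v u) $ i = 0"
    using nz by (simp add: Au b_def)
  then have "braket u (A *v u) = braket v (A *v u)"
    by (subst u_def) (simp only: braket_add_left braket_smult_left braket_axis_left, simp)
  ultimately show "0 \<le> braket v (?B *v v)"
    using A by (metis pos_semidef_def)
qed

text \<open>Cholesky elimination: a nonzero diagonal entry serves as pivot, a rank-one term is split
  off, and the Schur complement that remains has fewer nonzero diagonal entries.\<close>

lemma pos_semidef_sum_ketbra:
  assumes "pos_semidef A"
  shows "\<exists>vs. A = (\<Sum>v\<leftarrow>vs. ketbra v v)"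
  using assms
proof (induction "card {i. A $ i $ i \<noteq> 0}" arbitrary: A rule: less_induct)
  case less
  show ?case
  proof (cases "\<forall>i. A $ i $ i = 0")
    case True
    then have "A = (\<Sum>v\<leftarrow>[]. ketbra v v)"
      using pos_semidef_zero_diag[OF less.prems] by simp
    then show ?thesis
      by blast
  next
    case False
    then obtain i where nz: "A $ i $ i \<noteq> 0"
      by blast
    define B where "B = (\<chi> j k. A $ j $ k - A $ j $ i * A $ i $ k / A $ i $ i)"
    define a where "a = Re (A $ i $ i)"
    have a: "A $ i $ i = of_real a" "a > 0"
      using pos_semidef_diag[OF less.prems, of i] nz
      by (auto simp: a_def less_eq_complex_def complex_eq_iff)
    have B: "pos_semidef B"
      unfolding B_def by (rule pos_semidef_schur_complement[OF less.prems nz])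
    \<comment> \<open>Elimination creates no new nonzero diagonal entry: it could only make a zero
      entry negative, which positivity of \<open>B\<close> forbids.\<close>
    have "B $ j $ j = 0" if "A $ j $ j = 0" for j
    proof -
      have eq: "B $ j $ j = - of_real ((norm (A $ j $ i))\<^sup>2 / a)"
        using that a pos_semidef_hermitian[OF less.prems, of i j]
        by (simp add: B_def complex_norm_square flip: of_real_power)
      have "(norm (A $ j $ i))\<^sup>2 / a \<le> 0"
        using pos_semidef_diag[OF B, of j] unfolding eq by (simp add: less_eq_complex_def)
      moreover have "0 \<le> (norm (A $ j $ i))\<^sup>2 / a"
        using a by simp
      ultimately have "(norm (A $ j $ i))\<^sup>2 / a = 0"
        by (rule antisym)
      then show ?thesis
        unfolding eq by simp
    qed
    moreover have "B $ i $ i = 0"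
      using nz by (simp add: B_def)
    ultimately have "{j. B $ j $ j \<noteq> 0} \<subset> {j. A $ j $ j \<noteq> 0}"
      using nz by blast
    then have "card {j. B $ j $ j \<noteq> 0} < card {j. A $ j $ j \<noteq> 0}"
      by (intro psubset_card_mono) simp_all
    then obtain vs where vs: "B = (\<Sum>v\<leftarrow>vs. ketbra v v)"
      using less.hyps B by blast
    \<comment> \<open>The pivot column divided by the root of the pivot; by hermiticity
      \<open>ketbra w w\<close> is exactly the term subtracted in \<open>B\<close>.\<close>
    define w where "w = (\<chi> j. A $ j $ i / of_real (sqrt a))"
    have "ketbra w w $ j $ k = A $ j $ i * A $ i $ k / A $ i $ i" for j k
    proof -
      have "complex_of_real (sqrt a) * complex_of_real (sqrt a) = complex_of_real a"
        using a by (simp flip: of_real_mult)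
      then show ?thesis
        using a pos_semidef_hermitian[OF less.prems, of i k]
        by (simp add: ketbra_def w_def)
    qed
    then have "A = ketbra w w + B"
      by (simp add: vec_eq_iff B_def)
    then have "A = (\<Sum>v\<leftarrow>w # vs. ketbra v v)"
      by (simp add: vs)
    then show ?thesis
      by blast
  qed
qed

section \<open>Outcome sets\<close>

lemma matrix_mult_add_left: "(A + B) ** C = A ** C + B ** (C :: complex^'n^'n)"
  by (simp add: vec_eq_iff matrix_matrix_mult_def algebra_simps sum.distrib)

lemma quantum_channel_add:
  assumes "quantum_channel \<E>"
  shows "\<E> (A + B) = \<E> A + \<E> B"
  using assms unfolding quantum_channel_def
  by (auto simp: matrix_add_ldistrib matrix_mult_add_left sum.distrib)

lemma quantum_channel_zero:
  assumes "quantum_channel \<E>"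
  shows "\<E> 0 = 0"
  using quantum_channel_add[OF assms, of 0 0] by simp

lemma trace_zero: "trace (0 :: complex^'n^'n) = 0"
  by (simp add: trace_def)

lemma trace_sum: "trace (\<Sum>a\<in>I. f a :: complex^'n^'n) = (\<Sum>a\<in>I. trace (f a))"
  by (induction I rule: infinite_finite_induct) (simp_all add: trace_add trace_zero)

lemma matrix_mult_sum_left: "(\<Sum>a\<in>I. f a) ** (M :: complex^'n^'n) = (\<Sum>a\<in>I. f a ** M)"
  by (induction I rule: infinite_finite_induct) (simp_all add: matrix_mult_add_left)

lemma matrix_vector_mult_sum_left:
  "(\<Sum>a\<in>I. f a) *v (v :: complex^'n) = (\<Sum>a\<in>I. f a *v v)"
  by (induction I rule: infinite_finite_induct) (simp_all add: matrix_vector_mult_add_rdistrib)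

lemma braket_sum_right: "braket u (\<Sum>a\<in>I. f a) = (\<Sum>a\<in>I. braket u (f a))"
  by (induction I rule: infinite_finite_induct)
    (simp_all add: braket_add_right, simp_all add: braket_def)

section \<open>Outcome probabilities of rank-one inputs and their sums\<close>

lemma trace_channel_ketbra_nonneg:
  assumes "quantum_channel \<E>" and "pos_semidef M"
  shows "0 \<le> trace (\<E> (ketbra v v) ** M)"
proof -
  obtain m :: nat and K where "\<And>\<rho>. \<E> \<rho> = (\<Sum>a<m. K a ** \<rho> ** conj_transpose (K a))"
    using assms(1) unfolding quantum_channel_def by blast
  \<comment> \<open>The trace is the sum over \<open>a\<close> of the form of \<open>M\<close> at
    \<open>K a *v v\<close>.\<close>
  then show ?thesis
    using assms(2)
    by (simp add: matrix_mult_ketbra_conj_transpose matrix_mult_sum_left trace_sum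
        trace_ketbra_mult pos_semidef_def sum_nonneg)
qed

text \<open>Trace preservation: moving each \<open>K a\<close> across the bracket collects the
  completeness sum of the Kraus operators.\<close>

lemma trace_channel_ketbra:
  assumes "quantum_channel \<E>"
  shows "trace (\<E> (ketbra v v)) = of_real ((norm v)\<^sup>2)"
proof -
  obtain m :: nat and K where
    K: "(\<Sum>a<m. conj_transpose (K a) ** K a) = mat 1" and
    \<E>: "\<And>\<rho>. \<E> \<rho> = (\<Sum>a<m. K a ** \<rho> ** conj_transpose (K a))"
    using assms unfolding quantum_channel_def by blast
  have "trace (\<E> (ketbra v v)) = (\<Sum>a<m. braket (K a *v v) (K a *v v))"
    by (simp add: \<E> matrix_mult_ketbra_conj_transpose trace_sum trace_ketbra braket_self)
  also have "\<dots> = braket v ((\<Sum>a<m. conj_transpose (K a) ** K a) *v v)"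
    by (simp add: matrix_vector_mult_sum_left braket_sum_right braket_conj_transpose
        flip: matrix_vector_mul_assoc)
  finally show ?thesis
    by (simp add: K braket_self)
qed

lemma trace_channel_sum_ketbra_nonneg:
  assumes "quantum_channel \<E>" and "pos_semidef M"
  shows "0 \<le> trace (\<E> (\<Sum>v\<leftarrow>vs. ketbra v v) ** M)"
  by (induction vs)
    (simp_all add: quantum_channel_zero[OF assms(1)] quantum_channel_add[OF assms(1)]
      matrix_mult_add_left trace_add trace_zero trace_channel_ketbra_nonneg[OF assms])

text \<open>The remaining summands contribute nonnegatively. Hence an outcome possible for one
  summand is possible for the whole sum.\<close>

lemma trace_channel_sum_ketbra_ge:
  assumes "quantum_channel \<E>" and "pos_semidef M" and "w \<in> set vs"
  shows "trace (\<E> (ketbra w w) ** M) \<le> trace (\<E> (\<Sum>v\<leftarrow>vs. ketbra v v) ** M)"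
  using assms(3)
proof (induction vs)
  case (Cons u vs)
  have eq: "trace (\<E> (\<Sum>v\<leftarrow>u # vs. ketbra v v) ** M)
      = trace (\<E> (ketbra u u) ** M) + trace (\<E> (\<Sum>v\<leftarrow>vs. ketbra v v) ** M)"
    by (simp add: quantum_channel_add[OF assms(1)] matrix_mult_add_left trace_add)
  show ?case
  proof (cases "w = u")
    case True
    then show ?thesis
      unfolding eq using trace_channel_sum_ketbra_nonneg[OF assms(1,2)] by simp
  next
    case False
    then show ?thesis
      unfolding eq using Cons trace_channel_ketbra_nonneg[OF assms(1,2), of u]
      by (simp add: add_increasing)
  qed
qed simp

text \<open>Scaling multiplies every probability by \<open>c * cnj c\<close>, so a positive value
  after scaling excludes zero before it. The case \<open>c = 0\<close> allows only an
  inclusion.\<close>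

lemma outcomes_ketbra_smult_subset:
  assumes "quantum_channel \<E>" and "povm P"
  shows "outcomes \<E> P (ketbra (c *s v) (c *s v)) \<subseteq> outcomes \<E> P (ketbra v v)"
proof
  obtain m :: nat and K where \<E>: "\<And>\<rho>. \<E> \<rho> = (\<Sum>a<m. K a ** \<rho> ** conj_transpose (K a))"
    using assms(1) unfolding quantum_channel_def by blast
  fix j
  assume j: "j \<in> outcomes \<E> P (ketbra (c *s v) (c *s v))"
  have "trace (\<E> (ketbra (c *s v) (c *s v)) ** P ! j) = c * cnj c * trace (\<E> (ketbra v v) ** P ! j)"
    by (simp add: \<E> matrix_mult_ketbra_conj_transpose matrix_mult_sum_left trace_sum
        trace_ketbra_mult braket_smult_left braket_smult_right sum_distrib_left
        vector_scalar_commute algebra_simps)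
  moreover have "0 \<le> trace (\<E> (ketbra v v) ** P ! j)"
    using assms j by (intro trace_channel_ketbra_nonneg) (auto simp: outcomes_def povm_def)
  ultimately show "j \<in> outcomes \<E> P (ketbra v v)"
    using j by (auto simp: outcomes_def less_le)
qed

lemma trace_mult_sum_list:
  "trace ((A :: complex^'n^'n) ** sum_list Ms) = (\<Sum>M\<leftarrow>Ms. trace (A ** M))"
  by (induction Ms) (simp_all add: matrix_add_ldistrib trace_add trace_zero)

text \<open>Otherwise all probabilities vanish by nonnegativity, yet their sum is the trace of the
  channel output, which is 1.\<close>

lemma outcomes_pure_state_nonempty:
  assumes "quantum_channel \<E>" and "povm P" and "pure_state \<rho>"
  shows "outcomes \<E> P \<rho> \<noteq> {}"
proof
  assume empty: "outcomes \<E> P \<rho> = {}"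
  obtain v where v: "norm v = 1" "\<rho> = ketbra v v"
    using assms(3) unfolding pure_state_def by blast
  have "trace (\<E> \<rho> ** M) = 0" if M: "M \<in> set P" for M
  proof -
    obtain j where "j < length P" "P ! j = M"
      using M by (auto simp: in_set_conv_nth)
    then have "\<not> 0 < trace (\<E> \<rho> ** M)"
      using empty unfolding outcomes_def by blast
    moreover have "0 \<le> trace (\<E> \<rho> ** M)"
      using assms M trace_channel_ketbra_nonneg unfolding v povm_def by blast
    ultimately show ?thesis
      by (simp add: less_le)
  qed
  then have "(\<Sum>M\<leftarrow>P. trace (\<E> \<rho> ** M)) = (\<Sum>M\<leftarrow>P. 0)"
    by (intro arg_cong[where f = sum_list] map_cong) simp_all
  then have "trace (\<E> \<rho> ** sum_list P) = 0"
    by (simp add: trace_mult_sum_list)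
  then have "trace (\<E> \<rho>) = 0"
    using assms(2) by (simp add: povm_def)
  then show False
    using trace_channel_ketbra[OF assms(1), of v] v by simp
qed

lemma pure_state_outcomes_subset:
  assumes \<E>: "quantum_channel \<E>" and P: "povm P" and \<rho>: "quantum_state \<rho>"
  shows "\<exists>\<sigma>. pure_state \<sigma> \<and> outcomes \<E> P \<sigma> \<subseteq> outcomes \<E> P \<rho>"
proof -
  obtain vs where vs: "\<rho> = (\<Sum>v\<leftarrow>vs. ketbra v v)"
    using pos_semidef_sum_ketbra \<rho> unfolding quantum_state_def by blast
  \<comment> \<open>Trace one rules out that \<open>vs\<close> is empty or contains only zero
    vectors.\<close>
  have "\<exists>v\<in>set vs. v \<noteq> 0"
  proof (rule ccontr)
    assume "\<not> ?thesis"
    then have "trace (\<Sum>v\<leftarrow>vs. ketbra v v) = 0"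
      by (induction vs) (simp_all add: trace_zero trace_add trace_ketbra)
    with \<rho> vs show False
      by (simp add: quantum_state_def)
  qed
  then obtain v where v: "v \<in> set vs" "v \<noteq> 0"
    by blast
  define u where "u = complex_of_real (inverse (norm v)) *s v"
  have "norm u = 1"
  proof -
    have "u = inverse (norm v) *\<^sub>R v"
      by (simp add: u_def vec_eq_iff scaleR_conv_of_real[where 'a = complex])
    then show ?thesis
      using v by simp
  qed
  then have "pure_state (ketbra u u)"
    unfolding pure_state_def by blast
  moreover have "outcomes \<E> P (ketbra u u) \<subseteq> outcomes \<E> P (ketbra v v)"
    unfolding u_def by (rule outcomes_ketbra_smult_subset[OF \<E> P])
  moreover have "outcomes \<E> P (ketbra v v) \<subseteq> outcomes \<E> P \<rho>"
    unfolding outcomes_def vs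
    using trace_channel_sum_ketbra_ge[OF \<E> _ v(1)] P
    by (auto simp: povm_def intro: less_le_trans)
  ultimately show ?thesis
    by blast
qed

lemma pure_state_quantum_state:
  assumes "pure_state \<rho>"
  shows "quantum_state \<rho>"
proof -
  obtain v where v: "norm v = 1" "\<rho> = ketbra v v"
    using assms unfolding pure_state_def by blast
  have "0 \<le> braket u (ketbra v v *v u)" for u
  proof -
    \<comment> \<open>The form of a rank-one projector is the squared modulus of an overlap.\<close>
    have "braket u (ketbra v v *v u) = braket u v * cnj (braket u v)"
      by (simp add: braket_def matrix_vector_mult_def ketbra_def sum_distrib_left
          sum_distrib_right algebra_simps)
    then show ?thesis
      by (simp add: less_eq_complex_def)
  qed
  then show ?thesis
    using v by (simp add: quantum_state_def pos_semidef_def trace_ketbra)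
qed

section \<open>Graph homomorphisms and clique numbers\<close>

text \<open>An edge is an unordered pair, so its endpoints may be read in either order; the
  coordinate condition is symmetric.\<close>

lemma product_graph_edge_iff:
  "{xs, ys} \<in> snd (product_graph n G) \<longleftrightarrow>
    xs \<in> fst (product_graph n G) \<and> ys \<in> fst (product_graph n G) \<and>
    (\<exists>i<n. {xs ! i, ys ! i} \<in> snd G)"
  unfolding product_graph_def Let_def
  by (auto simp: doubleton_eq_iff insert_commute)

lemma finite_product_graph: "finite (fst G) \<Longrightarrow> finite (fst (product_graph n G))"
  by (simp add: product_graph_def Let_def finite_lists_length_eq)

lemma finite_clique_cards:
  assumes "finite (fst G)"
  shows "finite {card C | C. C \<subseteq> fst G \<and> clique C (snd G)}"
  by (rule finite_subset[of _ "card ` Pow (fst G)"]) (use assms in auto)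

lemma clique_number_attained:
  assumes "finite (fst G)"
  obtains C where "C \<subseteq> fst G" "clique C (snd G)" "card C = clique_number G"
proof -
  \<comment> \<open>The empty clique makes the set under \<open>Max\<close> nonempty.\<close>
  have "card {} \<in> {card C | C. C \<subseteq> fst G \<and> clique C (snd G)}"
    by (rule CollectI, rule exI[of _ "{}"]) (simp add: clique_def)
  then have "clique_number G \<in> {card C | C. C \<subseteq> fst G \<and> clique C (snd G)}"
    unfolding clique_number_def using finite_clique_cards[OF assms] by (intro Max_in) auto
  then show ?thesis
    using that by auto
qed

lemma card_clique_le_clique_number:
  assumes "finite (fst G)" "C \<subseteq> fst G" "clique C (snd G)"
  shows "card C \<le> clique_number G"
  unfolding clique_number_def
  using finite_clique_cards[OF assms(1)] assms(2,3) by (intro Max_ge) auto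

text \<open>A homomorphism \<open>f\<close> into a loop-free graph acts coordinatewise on tuples. It
  may merge vertices not joined by an edge, but \<open>map f\<close> is still injective on every
  clique.\<close>

lemma clique_number_product_graph_mono:
  assumes fin: "finite (fst G)" "finite (fst H)"
    and vert: "f ` fst G \<subseteq> fst H"
    and edge: "\<And>x y. {x, y} \<in> snd G \<Longrightarrow> {f x, f y} \<in> snd H"
    and loop_free: "\<And>x. {x} \<notin> snd H"
  shows "clique_number (product_graph n G) \<le> clique_number (product_graph n H)"
proof -
  obtain C where C: "C \<subseteq> fst (product_graph n G)" "clique C (snd (product_graph n G))"
    "card C = clique_number (product_graph n G)"
    using clique_number_attained finite_product_graph[OF fin(1)] by blast
  have len: "length xs = n" if "xs \<in> C" for xs
    using that C(1) by (auto simp: product_graph_def Let_def)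
  have sub: "map f ` C \<subseteq> fst (product_graph n H)"
    using C(1) vert by (auto simp: product_graph_def Let_def) blast
  \<comment> \<open>This single fact yields both injectivity on \<open>C\<close> and the clique
    property of the image.\<close>
  have coord: "\<exists>i<n. {map f xs ! i, map f ys ! i} \<in> snd H"
    if "xs \<in> C" "ys \<in> C" "xs \<noteq> ys" for xs ys
  proof -
    have "{xs, ys} \<in> snd (product_graph n G)"
      using C(2) that by (simp add: clique_def)
    then obtain i where "i < n" "{xs ! i, ys ! i} \<in> snd G"
      unfolding product_graph_edge_iff by blast
    then show ?thesis
      using edge len that by auto
  qed
  have "inj_on (map f) C"
  proof (rule inj_onI, rule ccontr)
    fix xs ys
    assume "xs \<in> C" "ys \<in> C" "map f xs = map f ys" "xs \<noteq> ys"
    then show False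
      \<comment> \<open>If the images coincide, the edge from \<open>coord\<close> has equal
        endpoints and is a loop in \<open>H\<close>.\<close>
      using coord[of xs ys] loop_free by simp
  qed
  then have "clique_number (product_graph n G) = card (map f ` C)"
    by (simp add: card_image C(3))
  also have "clique (map f ` C) (snd (product_graph n H))"
    using sub coord unfolding clique_def product_graph_edge_iff by blast
  then have "card (map f ` C) \<le> clique_number (product_graph n H)"
    using sub finite_product_graph[OF fin(2)] by (intro card_clique_le_clique_number)
  finally show ?thesis .
qed

text \<open>A constant tuple forms a one-vertex clique. Positivity is what makes the comparison of
  logarithms valid.\<close>

lemma clique_number_product_graph_pos:
  assumes "finite (fst G)" "fst G \<noteq> {}"
  shows "0 < clique_number (product_graph n G)"
proof -
  obtain x where "x \<in> fst G"
    using assms(2) by blast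
  then have "{replicate n x} \<subseteq> fst (product_graph n G)"
    by (auto simp: product_graph_def Let_def)
  then have "card {replicate n x} \<le> clique_number (product_graph n G)"
    by (intro card_clique_le_clique_number finite_product_graph assms(1)) (simp_all add: clique_def)
  then show ?thesis
    by simp
qed

section \<open>Rates of characteristic graphs\<close>

lemma characteristic_graph_edge_iff:
  "{x, y} \<in> snd (characteristic_graph \<E> S P) \<longleftrightarrow> x \<in> S \<and> y \<in> S \<and> non_adjacent \<E> P x y"
  unfolding characteristic_graph_def
  by (auto simp: doubleton_eq_iff non_adjacent_def Int_commute)

lemma fst_characteristic_graph [simp]: "fst (characteristic_graph \<E> S P) = S"
  by (simp add: characteristic_graph_def)

text \<open>Shrinking outcome sets preserves their disjointness, so \<open>f\<close> is a
  homomorphism of characteristic graphs.\<close>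

lemma pair_rate_image_ge:
  assumes "finite S" "S \<noteq> {}"
    and sub: "\<And>\<rho>. \<rho> \<in> S \<Longrightarrow> outcomes \<E> P (f \<rho>) \<subseteq> outcomes \<E> P \<rho>"
    and ne: "\<And>\<rho>. \<rho> \<in> S \<Longrightarrow> outcomes \<E> P (f \<rho>) \<noteq> {}"
  shows "pair_rate \<E> S P \<le> pair_rate \<E> (f ` S) P"
proof -
  let ?G = "characteristic_graph \<E> S P" and ?H = "characteristic_graph \<E> (f ` S) P"
  have le: "clique_number (product_graph n ?G) \<le> clique_number (product_graph n ?H)" for n
  proof (rule clique_number_product_graph_mono)
    show "{f x, f y} \<in> snd ?H" if "{x, y} \<in> snd ?G" for x y
      using that sub[of x] sub[of y]
      unfolding characteristic_graph_edge_iff non_adjacent_def by blast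
    \<comment> \<open>A loop would make an outcome set disjoint from itself, hence empty.\<close>
    show "{x} \<notin> snd ?H" for x
      using ne characteristic_graph_edge_iff[of x x \<E> "f ` S" P]
      by (auto simp: non_adjacent_def)
  qed (use assms in auto)
  have pos: "0 < clique_number (product_graph n ?G)" for n
    using assms by (intro clique_number_product_graph_pos) simp_all
  show ?thesis
    unfolding pair_rate_def
  proof (rule SUP_mono)
    fix n :: nat
    assume n: "n \<in> {1..}"
    have "log 2 (real (clique_number (product_graph n ?G)))
        \<le> log 2 (real (clique_number (product_graph n ?H)))"
      using le[of n] pos[of n] by simp
    then have "1 / real n * log 2 (real (clique_number (product_graph n ?G)))
        \<le> 1 / real n * log 2 (real (clique_number (product_graph n ?H)))"
      by (intro mult_left_mono) simp_all
    then show "\<exists>m\<in>{1..}. ereal (1 / real n * log 2 (real (clique_number (product_graph n ?G))))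
        \<le> ereal (1 / real m * log 2 (real (clique_number (product_graph m ?H))))"
      using n by (intro bexI[of _ n]) simp_all
  qed
qed

theorem proposition3:
  fixes \<E> :: "complex^'d^'d \<Rightarrow> complex^'d^'d"
  assumes "quantum_channel \<E>"
    and "\<exists>S P. optimum_pair \<E> S P"
  shows "\<exists>S P. optimum_pair \<E> S P \<and> (\<forall>\<rho>\<in>S. pure_state \<rho>)"
proof -
  obtain S P where SP: "admissible_pair S P" and opt: "pair_rate \<E> S P = zero_error_capacity \<E>"
    using assms(2) unfolding optimum_pair_def by blast
  then have S: "finite S" "S \<noteq> {}" "\<forall>\<rho>\<in>S. quantum_state \<rho>" and P: "povm P"
    by (simp_all add: admissible_pair_def)
  \<comment> \<open>One pure state is chosen for each input, all relative to the same measurement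
    \<open>P\<close>, which is kept.\<close>
  obtain f where f: "\<And>\<rho>. \<rho> \<in> S \<Longrightarrow> pure_state (f \<rho>)"
    "\<And>\<rho>. \<rho> \<in> S \<Longrightarrow> outcomes \<E> P (f \<rho>) \<subseteq> outcomes \<E> P \<rho>"
    using pure_state_outcomes_subset[OF assms(1) P] S(3) by metis
  have "admissible_pair (f ` S) P"
    using S P f(1) pure_state_quantum_state by (auto simp: admissible_pair_def)
  moreover from this have "pair_rate \<E> (f ` S) P \<le> zero_error_capacity \<E>"
    unfolding zero_error_capacity_def by (intro SUP_upper2[where i = "(f ` S, P)"]) simp_all
  moreover have "zero_error_capacity \<E> \<le> pair_rate \<E> (f ` S) P"
    unfolding opt[symmetric]
    using S f outcomes_pure_state_nonempty[OF assms(1) P] by (intro pair_rate_image_ge) simp_all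
  ultimately have "optimum_pair \<E> (f ` S) P"
    unfolding optimum_pair_def by simp
  then show ?thesis
    using f(1) by blast
qed

end
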